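(* Let $k\ge1$ be an integer. We have $$N^{(k-1)(k-2)\cdots1k}_{12\text{-}3}(n)=\binom{n-1}{k-1}B_{n-k}.$$
   Context: A permutation $\pi=\pi_1\cdots\pi_n$ of $\{1,\dots,n\}$ contains the generalized pattern $12\text{-}3$ if there are indices $i,j$ with $i+1<j\le n$ such that $\pi_i\pi_{i+1}\pi_j$ is order-isomorphic to $123$; otherwise it avoids it. A permutation $\pi$ begins with a pattern $p=p_1\cdots p_k$ if $n\ge k$ and $\pi_1\cdots\pi_k$ is order-isomorphic to $p$; in addition, by convention, the empty permutation is assumed to begin with the pattern $1$. The pattern $(k-1)(k-2)\cdots1k$ consists of the letters $k-1,k-2,\dots,1$ in decreasing order followed by $k$ (for $k=1$ it is $1$, for $k=2$ it is $12$). $N^p_q(n)$ is the number of permutations of $\{1,\dots,n\}$ that avoid $q$ and begin with $p$. $B_m$ is the $m$th Bell number ($B_0=1$).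
   Formalization: The formal theorem requires k ≥ 2 instead of k ≥ 1: for k = 1 the left side is B_n and the right side is B_{n-1}, so the formula fails for every n ≥ 2 (at n = 2 it reads 2 = 1). *)

theory Defs
  imports "HOL-Combinatorics.Multiset_Permutations" "HOL-Library.Disjoint_Sets"
begin

definition order_iso :: "nat list \<Rightarrow> nat list \<Rightarrow> bool" where
  "order_iso xs ys \<longleftrightarrow> length xs = length ys \<and>
     (\<forall>i<length xs. \<forall>j<length xs. xs ! i < xs ! j \<longleftrightarrow> ys ! i < ys ! j)"

definition contains_12_3 :: "nat list \<Rightarrow> bool" where
  "contains_12_3 \<pi> \<longleftrightarrow>
     (\<exists>i j. i + 1 < j \<and> j < length \<pi> \<and> order_iso [\<pi> ! i, \<pi> ! (i + 1), \<pi> ! j] [1, 2, 3])"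

text \<open>The second disjunct is the convention that the empty permutation begins with the pattern 1.\<close>

definition begins_with :: "nat list \<Rightarrow> nat list \<Rightarrow> bool" where
  "begins_with \<pi> p \<longleftrightarrow>
     (length p \<le> length \<pi> \<and> order_iso (take (length p) \<pi>) p) \<or> (\<pi> = [] \<and> p = [1])"

definition N_12_3 :: "nat list \<Rightarrow> nat \<Rightarrow> nat" where
  "N_12_3 p n =
     card {\<pi> \<in> permutations_of_set {1..n}. \<not> contains_12_3 \<pi> \<and> begins_with \<pi> p}"

text \<open>The pattern $(k-1)(k-2)\cdots 1k$, for $k \ge 1$.\<close>

definition dec_then_max :: "nat \<Rightarrow> nat list" where
  "dec_then_max k = rev [1..<k] @ [k]"

definition Bell :: "nat \<Rightarrow> nat" where
  "Bell m = card {P. partition_on {1..m} P}"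

text \<open>
  For $k = 1$ the formula $N(n) = \binom{n-1}{k-1} B_{n-k}$ is false: a permutation starting with
  the pattern 1 need not have an ascent that forces the letter $n$ into position $k$, and
  for $n = 2$ both permutations count, whereas the right-hand side is $B_1 = 1$.
\<close>

lemma formula_fails_for_k_eq_1:
  "N_12_3 (dec_then_max 1) 2 = 2"
  "((2 - 1) choose (1 - 1)) * Bell (2 - 1) = 1"
proof -
  have A: "{1..2::nat} = {1, 2}" by auto
  have P: "permutations_of_set {1..2::nat} = {[1, 2], [2, 1]}"
    unfolding A by (rule permutations_of_set_doubleton) simp
  have "\<not> contains_12_3 [a, b]" for a b
    by (simp add: contains_12_3_def)
  moreover have "begins_with [a, b] (dec_then_max 1)" for a b
    by (simp add: begins_with_def order_iso_def dec_then_max_def)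
  ultimately have "{\<pi> \<in> permutations_of_set {1..2}. \<not> contains_12_3 \<pi> \<and> begins_with \<pi> (dec_then_max 1)}
        = {[1, 2], [2, 1]}"
    unfolding P by blast
  then show "N_12_3 (dec_then_max 1) 2 = 2"
    by (simp add: N_12_3_def)
  have "P = {{1}}" if "partition_on {1::nat} P" for P
  proof -
    have "p = {1}" if "p \<in> P" for p
      using that partition_onD1[OF \<open>partition_on {1} P\<close>] partition_onD3[OF \<open>partition_on {1} P\<close>]
      by (metis Sup_upper subset_singletonD)
    moreover have "P \<noteq> {}"
      using partition_onD1[OF that] by auto
    ultimately show ?thesis by blast
  qed
  moreover have "partition_on {1::nat} {{1}}"
    by (auto simp: partition_on_def disjoint_def)
  ultimately have "{P. partition_on {1::nat} P} = {{{1}}}" by blast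
  then have "card {P. partition_on {1..1::nat} P} = 1"
    unfolding atLeastAtMost_singleton by (simp only: is_singletonI is_singleton_altdef[symmetric])
  then show "((2 - 1) choose (1 - 1)) * Bell (2 - 1) = 1"
    by (simp add: Bell_def)
qed

end

theory Submission
  imports Defs
begin

text \<open>
  Cut a permutation of a finite set $A$ with maximum $m$ at $m$, as $\rho\, m\, \sigma$. It avoids
  12-3 iff $\rho$ is decreasing (an ascent of $\rho$ together with $m$ is an occurrence) and
  $\sigma$ avoids 12-3. So an avoider amounts to the set $S \subseteq A \setminus \{m\}$ of
  letters of $\rho$ together with an avoider on $A \setminus (S \cup \{m\})$. Set partitions
  decompose in the same way, $S \cup \{m\}$ being the block of $m$; hence avoiders are counted by
  the Bell numbers. An avoider begins with $(k-1)\cdots 1k$ exactly if $|S| = k - 1$.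
\<close>

section \<open>Occurrences of 12-3 and the cut at the maximum\<close>

lemma contains_12_3_iff:
  "contains_12_3 p \<longleftrightarrow>
     (\<exists>i j. i + 1 < j \<and> j < length p \<and> p ! i < p ! (i + 1) \<and> p ! (i + 1) < p ! j)"
proof -
  have "order_iso [a, b, c] [1, 2, 3] \<longleftrightarrow> a < b \<and> b < c" for a b c
    by (auto simp: order_iso_def All_less_Suc numeral_3_eq_3 numeral_2_eq_2)
  then show ?thesis
    unfolding contains_12_3_def by simp
qed

lemma contains_12_3_Nil: "\<not> contains_12_3 []"
  by (simp add: contains_12_3_iff)

lemma contains_12_3_singleton: "\<not> contains_12_3 [x]"
  by (simp add: contains_12_3_iff)

text \<open>The adjacent pair of an occurrence either sits at the first two positions or lies wholly
  in the tail. This recursion replaces index arguments by induction on the word.\<close>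

lemma contains_12_3_Cons_Cons:
  "contains_12_3 (x # y # zs) \<longleftrightarrow> (x < y \<and> (\<exists>z\<in>set zs. y < z)) \<or> contains_12_3 (y # zs)"
  (is "?L \<longleftrightarrow> ?R")
proof
  assume ?L
  then obtain i j where ij: "i + 1 < j" "j < length (x # y # zs)"
    "(x # y # zs) ! i < (x # y # zs) ! (i + 1)" "(x # y # zs) ! (i + 1) < (x # y # zs) ! j"
    unfolding contains_12_3_iff by blast
  show ?R
  proof (cases i)
    case 0
    then obtain l where "j = Suc (Suc l)"
      using ij(1) by (metis Suc_eq_plus1 add_0 less_imp_Suc_add add_Suc)
    then show ?thesis using ij 0 by auto
  next
    case (Suc i')
    moreover obtain j' where "j = Suc j'"
      using ij(1) by (cases j) auto
    ultimately have "i' + 1 < j' \<and> j' < length (y # zs) \<and> (y # zs) ! i' < (y # zs) ! (i' + 1)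
        \<and> (y # zs) ! (i' + 1) < (y # zs) ! j'"
      using ij by simp
    then show ?thesis unfolding contains_12_3_iff by blast
  qed
next
  assume ?R
  then show ?L
  proof
    assume "x < y \<and> (\<exists>z\<in>set zs. y < z)"
    then obtain l where "x < y" "l < length zs" "y < zs ! l"
      by (auto simp: in_set_conv_nth)
    then have "0 + 1 < l + 2 \<and> l + 2 < length (x # y # zs) \<and>
       (x # y # zs) ! 0 < (x # y # zs) ! (0 + 1) \<and> (x # y # zs) ! (0 + 1) < (x # y # zs) ! (l + 2)"
      by simp
    then show ?L unfolding contains_12_3_iff by blast
  next
    assume "contains_12_3 (y # zs)"
    then obtain i j where ij: "i + 1 < j" "j < length (y # zs)"
      "(y # zs) ! i < (y # zs) ! (i + 1)" "(y # zs) ! (i + 1) < (y # zs) ! j"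
      unfolding contains_12_3_iff by blast
    then have "Suc i + 1 < Suc j \<and> Suc j < length (x # y # zs) \<and>
       (x # y # zs) ! Suc i < (x # y # zs) ! (Suc i + 1) \<and>
       (x # y # zs) ! (Suc i + 1) < (x # y # zs) ! Suc j"
      by simp
    then show ?L unfolding contains_12_3_iff by blast
  qed
qed

text \<open>An occurrence that uses the head would need it as its smallest letter, but no later
  letter exceeds \<open>m\<close>.\<close>

lemma contains_12_3_max_Cons:
  assumes "\<forall>y\<in>set ys. y \<le> m"
  shows "contains_12_3 (m # ys) \<longleftrightarrow> contains_12_3 ys"
proof (cases ys)
  case Nil
  then show ?thesis by (simp add: contains_12_3_Nil contains_12_3_singleton)
next
  case (Cons a zs)
  then show ?thesis using assms by (auto simp: contains_12_3_Cons_Cons)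
qed

lemma avoids_12_3_split_at_max:
  assumes "distinct xs" "\<forall>x\<in>set xs. x < m" "\<forall>y\<in>set ys. y \<le> m"
  shows "\<not> contains_12_3 (xs @ m # ys) \<longleftrightarrow> sorted_wrt (>) xs \<and> \<not> contains_12_3 ys"
  using assms
proof (induction xs)
  case Nil
  then show ?case by (simp add: contains_12_3_max_Cons)
next
  case (Cons x xs)
  show ?case
  proof (cases xs)
    case Nil
    \<comment> \<open>Here the leading pair is \<open>x\<close>, \<open>m\<close>: an ascent, but a
      harmless one, since nothing in \<open>ys\<close> exceeds \<open>m\<close>.\<close>
    then show ?thesis using Cons.prems
      by (auto simp: contains_12_3_Cons_Cons contains_12_3_max_Cons dest: leD)
  next
    case (Cons y zs)
    have "transp ((>) :: nat \<Rightarrow> nat \<Rightarrow> bool)" by (auto intro: transpI)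
    then have "sorted_wrt (>) (x # xs) \<longleftrightarrow> y < x \<and> sorted_wrt (>) xs"
      unfolding Cons by (rule sorted_wrt2)
    \<comment> \<open>An ascent \<open>x < y\<close> is completed to an occurrence by
      \<open>m\<close>, which stands further right; distinctness turns the absence of an ascent into
      \<open>y < x\<close>.\<close>
    moreover have "\<not> contains_12_3 (x # xs @ m # ys) \<longleftrightarrow> y < x \<and> \<not> contains_12_3 (xs @ m # ys)"
      using Cons.prems Cons by (auto simp: contains_12_3_Cons_Cons)
    ultimately show ?thesis using Cons.IH Cons.prems by auto
  qed
qed

section \<open>Decomposition of avoiders at the maximum\<close>

definition avoiders :: "nat set \<Rightarrow> nat list set" where
  "avoiders A = {p \<in> permutations_of_set A. \<not> contains_12_3 p}"

text \<open>A decreasing word is determined by its set of letters, so the part before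
  \<open>m\<close> is recorded as a set only. Taking a pair as argument makes this a map on a
  dependent sum, whose cardinality is a sum over \<open>S\<close>.\<close>

definition join_at :: "nat \<Rightarrow> nat set \<times> nat list \<Rightarrow> nat list" where
  "join_at m = (\<lambda>(S, \<sigma>). rev (sorted_list_of_set S) @ m # \<sigma>)"

lemma finite_avoiders: "finite (avoiders A)"
  by (simp add: avoiders_def)

lemma bij_betw_join_at_avoiders:
  assumes "finite A" "m \<in> A" and max: "\<And>x. x \<in> A \<Longrightarrow> x \<le> m"
  shows "bij_betw (join_at m) (SIGMA S:Pow (A - {m}). avoiders (A - {m} - S)) (avoiders A)"
  unfolding bij_betw_def
proof
  show "inj_on (join_at m) (SIGMA S:Pow (A - {m}). avoiders (A - {m} - S))"
  proof (rule inj_onI, clarify)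
    fix S \<sigma> T \<tau>
    assume S: "S \<subseteq> A - {m}" and T: "T \<subseteq> A - {m}"
      and \<sigma>: "\<sigma> \<in> avoiders (A - {m} - S)" and \<tau>: "\<tau> \<in> avoiders (A - {m} - T)"
      and eq: "join_at m (S, \<sigma>) = join_at m (T, \<tau>)"
    have fin: "finite S" "finite T"
      using S T assms(1) finite_subset by blast+
    have "m \<notin> set \<sigma>"
      using \<sigma> by (auto simp: avoiders_def permutations_of_set_def)
    moreover have "m \<notin> set (rev (sorted_list_of_set S))"
      using S fin by auto
    \<comment> \<open>The cut is unambiguous because \<open>m\<close> occurs on neither side of
      it.\<close>
    ultimately have "rev (sorted_list_of_set S) = rev (sorted_list_of_set T) \<and> \<sigma> = \<tau>"
      using eq by (simp add: join_at_def append_Cons_eq_iff)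
    then show "S = T \<and> \<sigma> = \<tau>"
      using fin by (metis rev_rev_ident set_sorted_list_of_set)
  qed
next
  have "join_at m (S, \<sigma>) \<in> avoiders A"
    if S: "S \<subseteq> A - {m}" and \<sigma>: "\<sigma> \<in> avoiders (A - {m} - S)" for S \<sigma>
  proof -
    have fin: "finite S" using S assms(1) finite_subset by blast
    have \<sigma>': "set \<sigma> = A - {m} - S" "distinct \<sigma>" "\<not> contains_12_3 \<sigma>"
      using \<sigma> by (auto simp: avoiders_def permutations_of_set_def)
    have "\<forall>x\<in>set (rev (sorted_list_of_set S)). x < m"
      using S max fin by (auto simp: order_less_le)
    moreover have "\<forall>y\<in>set \<sigma>. y \<le> m" using \<sigma>' max by auto
    moreover have "sorted_wrt (>) (rev (sorted_list_of_set S))"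
      by (simp add: sorted_wrt_rev)
    ultimately have "\<not> contains_12_3 (join_at m (S, \<sigma>))"
      using \<sigma>'(3) by (simp add: join_at_def avoids_12_3_split_at_max)
    moreover have "set (join_at m (S, \<sigma>)) = A" "distinct (join_at m (S, \<sigma>))"
      using \<sigma>' S fin assms(2) by (auto simp: join_at_def)
    ultimately show ?thesis by (simp add: avoiders_def permutations_of_set_def)
  qed
  moreover have "p \<in> join_at m ` (SIGMA S:Pow (A - {m}). avoiders (A - {m} - S))"
    if "p \<in> avoiders A" for p
  proof -
    have p: "set p = A" "distinct p" "\<not> contains_12_3 p"
      using that by (auto simp: avoiders_def permutations_of_set_def)
    then obtain xs \<sigma> where split: "p = xs @ m # \<sigma>"
      using assms(2) by (metis split_list)
    have "\<forall>x\<in>set xs. x < m" "\<forall>y\<in>set \<sigma>. y \<le> m"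
      using p max unfolding split by (auto simp: order_less_le)
    then have dec: "sorted_wrt (>) xs" and \<sigma>: "\<not> contains_12_3 \<sigma>"
      using p(2,3) avoids_12_3_split_at_max[of xs m \<sigma>] unfolding split by auto
    \<comment> \<open>Reversed, \<open>xs\<close> is strictly increasing, so it is the sorted list
      of its own letters.\<close>
    have "sorted_list_of_set (set (rev xs)) = rev xs"
      using dec by (intro sorted_list_of_set.idem_if_sorted_distinct)
        (use strict_sorted_iff[of "rev xs"] in \<open>auto simp: sorted_wrt_rev\<close>)
    then have "p = join_at m (set xs, \<sigma>)"
      by (simp add: join_at_def split)
    moreover have "set xs \<subseteq> A - {m}" "\<sigma> \<in> avoiders (A - {m} - set xs)"
      using p(1,2) \<sigma> unfolding split by (auto simp: avoiders_def permutations_of_set_def)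
    ultimately show ?thesis by (intro image_eqI[of _ _ "(set xs, \<sigma>)"]) auto
  qed
  ultimately show "join_at m ` (SIGMA S:Pow (A - {m}). avoiders (A - {m} - S)) = avoiders A"
    by auto
qed

section \<open>Set partitions and Bell numbers\<close>

text \<open>The inverse takes out the block that contains \<open>m\<close> and deletes
  \<open>m\<close> from it. The domain has the shape of that in
  \<open>bij_betw_join_at_avoiders\<close>, with partitions in place of avoiders.\<close>

lemma bij_betw_insert_block_partitions:
  assumes "m \<in> A"
  shows "bij_betw (\<lambda>(S, Q). insert (insert m S) Q)
    (SIGMA S:Pow (A - {m}). {Q. partition_on (A - {m} - S) Q}) {P. partition_on A P}"
  unfolding bij_betw_def
proof
  show "inj_on (\<lambda>(S, Q). insert (insert m S) Q)
    (SIGMA S:Pow (A - {m}). {Q. partition_on (A - {m} - S) Q})"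
  proof (rule inj_onI, clarify)
    fix S P T Q
    assume S: "S \<subseteq> A - {m}" and T: "T \<subseteq> A - {m}"
      and P: "partition_on (A - {m} - S) P" and Q: "partition_on (A - {m} - T) Q"
      and eq: "insert (insert m S) P = insert (insert m T) Q"
    have "m \<notin> p" if "p \<in> P" for p using that partition_onD1[OF P] by auto
    moreover have "m \<notin> q" if "q \<in> Q" for q using that partition_onD1[OF Q] by auto
    \<comment> \<open>On either side of \<open>eq\<close> the inserted block is the only one that
      contains \<open>m\<close>.\<close>
    ultimately have "insert m S = insert m T" "insert m S \<notin> P" "insert m T \<notin> Q"
      using eq by blast+
    moreover from this have "P = Q" using eq by (metis insert_ident)
    moreover have "S = T" using \<open>insert m S = insert m T\<close> S T by blast
    ultimately show "S = T \<and> P = Q" by blast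
  qed
next
  have "partition_on A (insert (insert m S) Q)"
    if "S \<subseteq> A - {m}" "partition_on (A - {m} - S) Q" for S Q
  proof -
    have "A - insert m S = A - {m} - S" by auto
    moreover have "disjnt (insert m S) (\<Union>Q)"
      using partition_onD1[OF that(2)] by (auto simp: disjnt_def)
    ultimately show ?thesis using that assms by (auto simp: partition_on_insert)
  qed
  moreover have "P \<in> (\<lambda>(S, Q). insert (insert m S) Q) `
      (SIGMA S:Pow (A - {m}). {Q. partition_on (A - {m} - S) Q})"
    if P: "partition_on A P" for P
  proof -
    obtain p where p: "p \<in> P" "m \<in> p" using partition_onD1[OF P] assms by auto
    define S Q where "S = p - {m}" and "Q = P - {p}"
    have p_eq: "p = insert m S" and P_eq: "P = insert p Q" using p by (auto simp: S_def Q_def)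
    have "disjnt p (\<Union>Q)"
      using partition_onD2[OF P] p by (auto simp: Q_def disjnt_def disjoint_def)
    then have "partition_on (A - p) Q" "p \<subseteq> A"
      using P partition_on_insert[of p Q A] unfolding P_eq by auto
    moreover have "A - p = A - {m} - S" using p_eq by auto
    ultimately have "(S, Q) \<in> (SIGMA S:Pow (A - {m}). {Q. partition_on (A - {m} - S) Q})"
      by (auto simp: S_def)
    then show ?thesis using p_eq P_eq by (intro image_eqI[of _ _ "(S, Q)"]) auto
  qed
  ultimately show "(\<lambda>(S, Q). insert (insert m S) Q) `
      (SIGMA S:Pow (A - {m}). {Q. partition_on (A - {m} - S) Q}) = {P. partition_on A P}"
    by auto
qed

text \<open>The two bijections give both counts the same recursion. The induction is over proper
  subsets of \<open>A\<close>, because the letters left after removing \<open>m\<close> and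
  \<open>S\<close> need not form an interval.\<close>

lemma card_avoiders_eq_card_partitions:
  assumes "finite A"
  shows "card (avoiders A) = card {P. partition_on A P}"
  using assms
proof (induction A rule: finite_psubset_induct)
  case (psubset A)
  show ?case
  proof (cases "A = {}")
    case True
    have "avoiders {} = {[]}" by (auto simp: avoiders_def contains_12_3_Nil)
    then show ?thesis using True by (simp add: partition_on_empty)
  next
    case False
    define m where "m = Max A"
    have m: "m \<in> A" "\<And>x. x \<in> A \<Longrightarrow> x \<le> m"
      using False psubset.hyps by (auto simp: m_def)
    have fin: "finite (Pow (A - {m}))" using psubset.hyps by simp
    have "card (avoiders A) = card (SIGMA S:Pow (A - {m}). avoiders (A - {m} - S))"
      using bij_betw_same_card[OF bij_betw_join_at_avoiders[OF psubset.hyps m]] by simp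
    also have "\<dots> = (\<Sum>S\<in>Pow (A - {m}). card (avoiders (A - {m} - S)))"
      using fin by (intro card_SigmaI) (auto simp: finite_avoiders)
    also have "\<dots> = (\<Sum>S\<in>Pow (A - {m}). card {Q. partition_on (A - {m} - S) Q})"
      using m(1) by (intro sum.cong refl psubset.IH) auto
    also have "\<dots> = card (SIGMA S:Pow (A - {m}). {Q. partition_on (A - {m} - S) Q})"
      using fin psubset.hyps
      by (intro card_SigmaI[symmetric]) (auto intro!: finitely_many_partition_on)
    also have "\<dots> = card {P. partition_on A P}"
      by (rule bij_betw_same_card[OF bij_betw_insert_block_partitions[OF m(1)]])
    finally show ?thesis .
  qed
qed

text \<open>Mapping every block through \<open>f\<close> is injective on partitions. Equality
  follows later by using this for a bijection and for its inverse.\<close>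

lemma card_partitions_le:
  assumes f: "bij_betw f A B" and "finite B"
  shows "card {P. partition_on A P} \<le> card {P. partition_on B P}"
proof (rule card_inj_on_le)
  have inj: "inj_on f A" and img: "f ` A = B"
    using f by (auto simp: bij_betw_def)
  have "{P. partition_on A P} \<subseteq> Pow (Pow A)"
    by (auto dest: partition_onD1)
  then show "inj_on ((`) ((`) f)) {P. partition_on A P}"
    using inj_on_image_Pow[OF inj_on_image_Pow[OF inj]] by (rule inj_on_subset[rotated])
  have "partition_on B ((`) f ` P)" if "partition_on A P" for P
  proof -
    have "{} \<notin> (`) f ` P" using partition_onD3[OF that] by auto
    then show ?thesis using partition_on_inj_image[OF that inj] by (simp add: img)
  qed
  then show "(`) ((`) f) ` {P. partition_on A P} \<subseteq> {P. partition_on B P}" by auto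
  show "finite {P. partition_on B P}" using assms(2) by (rule finitely_many_partition_on)
qed

lemma card_partitions_eq_Bell:
  assumes "finite A"
  shows "card {P. partition_on A P} = Bell (card A)"
proof -
  obtain f where f: "bij_betw f A {1..card A}"
    using assms by (metis finite_same_card_bij finite_atLeastAtMost card_atLeastAtMost diff_Suc_1)
  have "card {P. partition_on A P} \<le> card {P. partition_on {1..card A} P}"
    using f by (intro card_partitions_le) auto
  moreover have "card {P. partition_on {1..card A} P} \<le> card {P. partition_on A P}"
    using bij_betw_inv_into[OF f] assms by (intro card_partitions_le) auto
  ultimately show ?thesis by (simp add: Bell_def)
qed

section \<open>Avoiders that begin with the pattern\<close>

lemma length_dec_then_max: "k \<ge> 1 \<Longrightarrow> length (dec_then_max k) = k"
  by (simp add: dec_then_max_def)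

lemma nth_dec_then_max:
  assumes "i < k"
  shows "dec_then_max k ! i = (if i = k - 1 then k else k - 1 - i)"
  using assms by (auto simp: dec_then_max_def nth_append rev_nth)

text \<open>The last letter of the pattern exceeds all others, which forces \<open>m\<close> into
  (zero-based) position \<open>k - 1\<close>. If \<open>xs\<close> is longer, the prefix of length
  \<open>k\<close> lies in a decreasing word; if shorter, \<open>m\<close> comes before the end of
  the prefix and would have to be exceeded. With \<open>k \<ge> 2\<close> there is a position before
  the last to compare with.\<close>

lemma begins_with_dec_then_max_iff:
  assumes "k \<ge> 2" "sorted_wrt (>) xs" "\<forall>x\<in>set xs. x < m" "\<forall>y\<in>set ys. y < m"
  shows "begins_with (xs @ m # ys) (dec_then_max k) \<longleftrightarrow> length xs = k - 1"
proof
  let ?p = "xs @ m # ys"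
  assume "begins_with ?p (dec_then_max k)"
  then have len: "k \<le> length ?p" and iso: "order_iso (take k ?p) (dec_then_max k)"
    using assms(1) by (auto simp: begins_with_def length_dec_then_max)
  have last_greater: "?p ! i < ?p ! (k - 1)" if "i < k - 1" for i
  proof -
    have "take k ?p ! i < take k ?p ! (k - 1) \<longleftrightarrow> dec_then_max k ! i < dec_then_max k ! (k - 1)"
      using iso len that unfolding order_iso_def by auto
    then show ?thesis using that by (simp add: nth_dec_then_max del: take_append)
  qed
  show "length xs = k - 1"
  proof (rule ccontr)
    assume "length xs \<noteq> k - 1"
    then consider "length xs > k - 1" | "length xs < k - 1" by linarith
    then show False
    proof cases
      case 1
      then have "xs ! 0 < xs ! (k - 1)"
        using last_greater[of 0] assms(1) by (auto simp: nth_append split: if_splits)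
      moreover have "xs ! 0 > xs ! (k - 1)"
        using 1 assms(1,2) by (auto simp: sorted_wrt_iff_nth_less)
      ultimately show False by simp
    next
      case 2
      then have "m < ?p ! (k - 1)" using last_greater[of "length xs"] by simp
      moreover have "?p ! (k - 1) \<in> set ?p" using len assms(1) by (intro nth_mem) linarith
      ultimately show False using assms(3,4) by (auto dest: less_asym)
    qed
  qed
next
  let ?p = "xs @ m # ys"
  assume len: "length xs = k - 1"
  have tk: "take k ?p = xs @ [m]"
    using len assms(1) by (simp add: take_Cons')
  \<comment> \<open>Entries of \<open>xs\<close> compare in the reverse order of their positions, as
    do the entries \<open>k - 1 - i\<close> of the pattern.\<close>
  have anti: "xs ! i < xs ! j \<longleftrightarrow> j < i" if "i < k - 1" "j < k - 1" for i j
    using that assms(2) len unfolding sorted_wrt_iff_nth_less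
    by (metis linorder_neqE_nat order_less_asym order_less_irrefl)
  have lt: "xs ! i < m" if "i < k - 1" for i
    using that assms(3) len by simp
  have "(xs @ [m]) ! i < (xs @ [m]) ! j \<longleftrightarrow> dec_then_max k ! i < dec_then_max k ! j"
    if "i < k" "j < k" for i j
  proof -
    have "i < k - 1 \<or> i = k - 1" "j < k - 1 \<or> j = k - 1" using that by auto
    then consider "i < k - 1" "j < k - 1" | "i < k - 1" "j = k - 1" | "i = k - 1" "j < k - 1"
      | "i = k - 1" "j = k - 1" by blast
    then show ?thesis
    proof cases
      case 1
      then show ?thesis using len anti[of i j] by (auto simp: nth_append nth_dec_then_max)
    next
      case 2
      then show ?thesis using len lt[of i] by (auto simp: nth_append nth_dec_then_max)
    next
      case 3
      then show ?thesis using len lt[of j] by (auto simp: nth_append nth_dec_then_max)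
    qed auto
  qed
  then have "order_iso (xs @ [m]) (dec_then_max k)"
    using len assms(1) by (auto simp: order_iso_def length_dec_then_max)
  then show "begins_with ?p (dec_then_max k)"
    using len assms(1) tk by (auto simp: begins_with_def length_dec_then_max)
qed

text \<open>The bound is \<open>k \<ge> 2\<close> because the formula is false for
  \<open>k = 1\<close>, as \<open>formula_fails_for_k_eq_1\<close> shows. The bijection of avoiders
  is restricted to sets \<open>S\<close> of size \<open>k - 1\<close>, and each of them contributes
  the same Bell number.\<close>

theorem proposition16:
  fixes k n :: nat
  assumes "k \<ge> 2"
  shows "N_12_3 (dec_then_max k) n = ((n - 1) choose (k - 1)) * Bell (n - k)"
proof (cases "n = 0")
  case True
  have "\<not> begins_with [] (dec_then_max k)"
    using assms by (auto simp: begins_with_def dec_then_max_def)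
  then have "N_12_3 (dec_then_max k) 0 = 0"
    by (auto simp: N_12_3_def)
  \<comment> \<open>Truncated subtraction makes the upper index 0, while \<open>k - 1\<close> is
    positive, so the binomial coefficient vanishes.\<close>
  then show ?thesis using True assms by (simp add: binomial_eq_0)
next
  case False
  define A where "A = {1..n} - {n}"
  have A: "finite A" "card A = n - 1" "n \<notin> A" "\<And>x. x \<in> A \<Longrightarrow> x < n"
    using False by (auto simp: A_def)
  \<comment> \<open>The possible sets of letters before \<open>n\<close>. For \<open>n < k\<close>
    there are none, and the binomial coefficient is 0 as well.\<close>
  define I where "I = {S. S \<subseteq> A \<and> card S = k - 1}"
  have "finite I" using A(1) by (simp add: I_def)
  have bij: "bij_betw (join_at n) (SIGMA S:Pow A. avoiders (A - S)) (avoiders {1..n})"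
    unfolding A_def using False by (intro bij_betw_join_at_avoiders) auto
  have begins: "begins_with (join_at n (S, \<sigma>)) (dec_then_max k) \<longleftrightarrow> card S = k - 1"
    if "S \<subseteq> A" "\<sigma> \<in> avoiders (A - S)" for S \<sigma>
  proof -
    have "finite S" using that A(1) finite_subset by blast
    then have "\<forall>x\<in>set (rev (sorted_list_of_set S)). x < n"
      using A(4) that by auto
    moreover have "\<forall>y\<in>set \<sigma>. y < n"
      using that A(4) by (auto simp: avoiders_def permutations_of_set_def)
    moreover have "sorted_wrt (>) (rev (sorted_list_of_set S))"
      by (simp add: sorted_wrt_rev)
    ultimately show ?thesis
      using assms by (simp add: join_at_def begins_with_dec_then_max_iff)
  qed
  have "{\<pi> \<in> permutations_of_set {1..n}. \<not> contains_12_3 \<pi> \<and> begins_with \<pi> (dec_then_max k)}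
      = {\<pi> \<in> avoiders {1..n}. begins_with \<pi> (dec_then_max k)}"
    by (auto simp: avoiders_def)
  also have "\<dots> = join_at n ` (SIGMA S:I. avoiders (A - S))"
    unfolding bij_betw_imp_surj_on[OF bij, symmetric] using begins by (auto simp: I_def)
  finally have "N_12_3 (dec_then_max k) n = card (join_at n ` (SIGMA S:I. avoiders (A - S)))"
    by (simp add: N_12_3_def)
  also have "\<dots> = card (SIGMA S:I. avoiders (A - S))"
    using bij_betw_imp_inj_on[OF bij]
    by (intro card_image) (auto simp: I_def elim: inj_on_subset)
  also have "\<dots> = (\<Sum>S\<in>I. card (avoiders (A - S)))"
    using \<open>finite I\<close> by (intro card_SigmaI) (auto simp: finite_avoiders)
  also have "\<dots> = (\<Sum>S\<in>I. Bell (n - k))"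
  proof (rule sum.cong[OF refl])
    fix S assume "S \<in> I"
    then have S: "S \<subseteq> A" "card S = k - 1" by (auto simp: I_def)
    \<comment> \<open>Of the \<open>n - 1\<close> letters below \<open>n\<close>, the
      \<open>k - 1\<close> in \<open>S\<close> are removed.\<close>
    then have "card (A - S) = n - k"
      using A assms by (simp add: card_Diff_subset finite_subset)
    then show "card (avoiders (A - S)) = Bell (n - k)"
      using A(1) by (simp add: card_avoiders_eq_card_partitions card_partitions_eq_Bell)
  qed
  also have "\<dots> = ((n - 1) choose (k - 1)) * Bell (n - k)"
    using n_subsets[OF A(1)] A(2) by (simp add: I_def)
  finally show ?thesis .
qed

end
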